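(* For all $n\geq 0$, the homotopy type of $\mathbf{w}_n(X)$ is a homotopy invariant of $X$; that is, if $X$ and $Y$ are homotopy equivalent spaces, then $\mathbf{w}_n(X)$ and $\mathbf{w}_n(Y)$ are homotopy equivalent.
   Context: All spaces are Hausdorff and maps are continuous. $S^n$ is the unit $n$-sphere with basepoint $s_0=(1,0,\dots,0)$; a map $S^n\to X$ is essential if it is not null-homotopic. The $n$-dimensional infinite earring $\mathbb{E}_n$ is the shrinking wedge of copies $S^n_j$ ($j\in\mathbb{N}$) of $S^n$: as a set it is the one-point union $\bigvee_{j}S^n_j$ with wedge point $b_0$; a set $U$ is open iff $U\cap S^n_j$ is open in $S^n_j$ for all $j$ and, whenever $b_0\in U$, $S^n_j\subseteq U$ for all but finitely many $j$. (For $n=0$, $\mathbb{E}_0\cong\{1,1/2,1/3,\dots,0\}$ with basepoint $0$.) A map $f:\mathbb{E}_n\to X$ is fully essential if its restriction to $S^n_j$ is essential in $X$ for every $j$. The $\pi_n$-wild set $\mathbf{w}_n(X)$ is the subspace of all $x\in X$ for which there is a fully essential map $(\mathbb{E}_n,b_0)\to(X,x)$. *)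

theory Defs
  imports "HOL-Analysis.Analysis"
begin

text \<open>The \<open>n\<close>-sphere is the library's \<^const>\<open>nsphere\<close>, whose points are functions
  \<open>nat \<Rightarrow> real\<close> vanishing beyond index \<open>n\<close>; the coordinates are indexed from \<open>0\<close>.\<close>

definition sphere_base :: "nat \<Rightarrow> real" where
  "sphere_base = (\<lambda>i. if i = 0 then 1 else 0)"

lemma sphere_base_in_nsphere: "sphere_base \<in> topspace (nsphere n)"
  unfolding sphere_base_def by (rule in_topspace_nsphere)

definition null_homotopic_map :: "'a topology \<Rightarrow> 'b topology \<Rightarrow> ('a \<Rightarrow> 'b) \<Rightarrow> bool" where
  "null_homotopic_map S X f \<longleftrightarrow> (\<exists>c. homotopic_with (\<lambda>_. True) S X f (\<lambda>_. c))"

definition essential_map :: "nat \<Rightarrow> 'a topology \<Rightarrow> ((nat \<Rightarrow> real) \<Rightarrow> 'a) \<Rightarrow> bool" where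
  "essential_map n X f \<longleftrightarrow>
     continuous_map (nsphere n) X f \<and> \<not> null_homotopic_map (nsphere n) X f"

text \<open>In the one-point union of countably many spheres, \<^term>\<open>None\<close> is the wedge point \<open>b\<^sub>0\<close>, and
  \<open>Some (j, x)\<close> is the point \<open>x \<noteq> s\<^sub>0\<close> of the \<open>j\<close>-th sphere; \<open>earring_incl j\<close> is the inclusion
  of the \<open>j\<close>-th sphere.\<close>

type_synonym earring_point = "(nat \<times> (nat \<Rightarrow> real)) option"

definition earring_incl :: "nat \<Rightarrow> (nat \<Rightarrow> real) \<Rightarrow> earring_point" where
  "earring_incl j x = (if x = sphere_base then None else Some (j, x))"

definition earring_sphere :: "nat \<Rightarrow> nat \<Rightarrow> earring_point set" where
  "earring_sphere n j = earring_incl j ` topspace (nsphere n)"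

definition earring_open :: "nat \<Rightarrow> earring_point set \<Rightarrow> bool" where
  "earring_open n U \<longleftrightarrow>
     U \<subseteq> (\<Union>j. earring_sphere n j) \<and>
     (\<forall>j. openin (nsphere n) {x \<in> topspace (nsphere n). earring_incl j x \<in> U}) \<and>
     (None \<in> U \<longrightarrow> finite {j. \<not> earring_sphere n j \<subseteq> U})"

definition earring :: "nat \<Rightarrow> earring_point topology" where
  "earring n = topology (earring_open n)"

lemma istopology_earring_open: "istopology (earring_open n)"
  unfolding istopology_def
proof (intro conjI allI impI)
  fix U V assume U: "earring_open n U" and V: "earring_open n V"
  have "openin (nsphere n) {x \<in> topspace (nsphere n). earring_incl j x \<in> U \<inter> V}" for j
  proof -
    have "{x \<in> topspace (nsphere n). earring_incl j x \<in> U \<inter> V} =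
        {x \<in> topspace (nsphere n). earring_incl j x \<in> U} \<inter>
        {x \<in> topspace (nsphere n). earring_incl j x \<in> V}" by auto
    then show ?thesis using U V by (auto simp: earring_open_def)
  qed
  moreover have "finite {j. \<not> earring_sphere n j \<subseteq> U \<inter> V}" if "None \<in> U \<inter> V"
  proof -
    have "{j. \<not> earring_sphere n j \<subseteq> U \<inter> V} =
        {j. \<not> earring_sphere n j \<subseteq> U} \<union> {j. \<not> earring_sphere n j \<subseteq> V}" by auto
    then show ?thesis using U V that by (simp add: earring_open_def)
  qed
  ultimately show "earring_open n (U \<inter> V)"
    using U by (auto simp: earring_open_def)
next
  fix \<U> assume \<U>: "\<forall>U\<in>\<U>. earring_open n U"
  have "openin (nsphere n) {x \<in> topspace (nsphere n). earring_incl j x \<in> \<Union>\<U>}" for j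
  proof -
    have "{x \<in> topspace (nsphere n). earring_incl j x \<in> \<Union>\<U>} =
        (\<Union>U\<in>\<U>. {x \<in> topspace (nsphere n). earring_incl j x \<in> U})" by auto
    then show ?thesis using \<U> by (auto simp: earring_open_def)
  qed
  moreover have "finite {j. \<not> earring_sphere n j \<subseteq> \<Union>\<U>}" if None: "None \<in> \<Union>\<U>"
  proof -
    obtain U where U: "U \<in> \<U>" "None \<in> U" using None by auto
    then have "finite {j. \<not> earring_sphere n j \<subseteq> U}" using \<U> by (auto simp: earring_open_def)
    then show ?thesis by (rule rev_finite_subset) (use U in auto)
  qed
  moreover have "\<Union>\<U> \<subseteq> (\<Union>j. earring_sphere n j)"
    using \<U> unfolding earring_open_def by blast
  ultimately show "earring_open n (\<Union>\<U>)"
    by (simp add: earring_open_def)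
qed

lemma openin_earring: "openin (earring n) U \<longleftrightarrow> earring_open n U"
  by (simp add: earring_def istopology_earring_open)

lemma topspace_earring: "topspace (earring n) = (\<Union>j. earring_sphere n j)"
proof -
  have "{x \<in> topspace (nsphere n). earring_incl i x \<in> (\<Union>j. earring_sphere n j)} =
      topspace (nsphere n)" for i
    by (auto simp: earring_sphere_def)
  then have "earring_open n (\<Union>j. earring_sphere n j)"
    by (auto simp: earring_open_def UN_upper)
  then show ?thesis
    unfolding topspace_def openin_earring by (auto simp: earring_open_def)
qed

definition fully_essential :: "nat \<Rightarrow> 'a topology \<Rightarrow> (earring_point \<Rightarrow> 'a) \<Rightarrow> bool" where
  "fully_essential n X f \<longleftrightarrow>
     continuous_map (earring n) X f \<and> (\<forall>j. essential_map n X (f \<circ> earring_incl j))"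

definition wild_set :: "nat \<Rightarrow> 'a topology \<Rightarrow> 'a set" where
  "wild_set n X = {x \<in> topspace X. \<exists>f. fully_essential n X f \<and> f None = x}"

definition wild_space :: "nat \<Rightarrow> 'a topology \<Rightarrow> 'a topology" where
  "wild_space n X = subtopology X (wild_set n X)"

end

theory Submission imports Defs begin

text \<open>A map with a left homotopy inverse preserves essential maps, so it carries wild points to wild
  points. This applies to a homotopy equivalence and also to every stage of a homotopy that ends at
  the identity, because such a stage is itself homotopic to the identity. Hence the maps and the
  homotopies of a homotopy equivalence all restrict to the wild sets.\<close>

lemma wild_set_mapped_by_left_homotopy_invertible:
  assumes h: "continuous_map X Z h" and k: "continuous_map Z X k"
    and kh: "homotopic_with (\<lambda>_. True) X X (k \<circ> h) id"
    and x: "x \<in> wild_set n X"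
  shows "h x \<in> wild_set n Z"
proof -
  obtain f where f: "fully_essential n X f" and fx: "f None = x"
    using x by (auto simp: wild_set_def)
  have "essential_map n Z (h \<circ> f \<circ> earring_incl j)" for j
  proof -
    let ?e = "f \<circ> earring_incl j"
    have e: "continuous_map (nsphere n) X ?e" "\<not> null_homotopic_map (nsphere n) X ?e"
      using f by (auto simp: fully_essential_def essential_map_def)
    have "null_homotopic_map (nsphere n) X ?e" if "null_homotopic_map (nsphere n) Z (h \<circ> ?e)"
    proof -
      obtain c where "homotopic_with (\<lambda>_. True) (nsphere n) Z (h \<circ> ?e) (\<lambda>_. c)"
        using \<open>null_homotopic_map (nsphere n) Z (h \<circ> ?e)\<close> by (auto simp: null_homotopic_map_def)
      \<comment> \<open>Composing with \<open>k\<close> keeps the map null-homotopic, while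
        \<open>kh\<close> deforms the same composite \<open>k \<circ> h \<circ> ?e\<close> back to
        \<open>?e\<close>. Joining the two homotopies contracts \<open>?e\<close> to
        \<open>k c\<close>, against its being essential.\<close>
      then have "homotopic_with (\<lambda>_. True) (nsphere n) X (k \<circ> (h \<circ> ?e)) (k \<circ> (\<lambda>_. c))"
        using k by (rule homotopic_with_compose_continuous_map_left) auto
      moreover have "homotopic_with (\<lambda>_. True) (nsphere n) X (k \<circ> h \<circ> ?e) (id \<circ> ?e)"
        using kh e(1) by (rule homotopic_with_compose_continuous_map_right) auto
      ultimately have "homotopic_with (\<lambda>_. True) (nsphere n) X ?e (\<lambda>_. k c)"
        using homotopic_with_trans homotopic_with_symD by (fastforce simp: comp_def)
      then show ?thesis
        by (auto simp: null_homotopic_map_def)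
    qed
    then show ?thesis
      using e h by (auto simp: essential_map_def comp_assoc intro: continuous_map_compose)
  qed
  then have "fully_essential n Z (h \<circ> f)"
    using f h by (auto simp: fully_essential_def intro: continuous_map_compose)
  moreover have "h x \<in> topspace Z"
    using x h by (auto simp: wild_set_def continuous_map_def)
  ultimately show ?thesis
    using fx by (auto simp: wild_set_def)
qed

text \<open>The part of the homotopy from time \<open>t\<close> to time 1, stretched over the whole
  unit interval, is the required homotopy.\<close>

lemma homotopy_stage_homotopic_to_end:
  fixes t :: real
  assumes h: "continuous_map (prod_topology (top_of_set {0..1}) X) Y h" and t: "t \<in> {0..1}"
  shows "homotopic_with (\<lambda>_. True) X Y (\<lambda>x. h (t, x)) (\<lambda>x. h (1, x))"
proof -
  \<comment> \<open>Affine reparametrisation of time with 0 going to \<open>t\<close> and 1 going to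
    1.\<close>
  let ?r = "\<lambda>s::real. t + (1 - t) * s"
  have "?r s \<in> {0..1}" if s: "s \<in> {0..1}" for s
  proof -
    have "0 \<le> (1 - t) * s" "(1 - t) * s \<le> 1 - t"
      using s t by (auto intro: mult_left_le)
    then show ?thesis
      using t by simp
  qed
  then have "continuous_map (top_of_set {0..1}) (top_of_set {0..1}) ?r"
    by (auto intro!: continuous_intros)
  then have "continuous_map (prod_topology (top_of_set {0..1}) X)
      (prod_topology (top_of_set {0..1}) X) (\<lambda>z. (?r (fst z), snd z))"
    by (intro continuous_map_pairedI continuous_map_snd
        continuous_map_compose[OF continuous_map_fst, unfolded comp_def])
  from continuous_map_compose[OF this h] show ?thesis
    unfolding homotopic_with_def
    by (intro exI[of _ "h \<circ> (\<lambda>z. (?r (fst z), snd z))"]) auto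
qed

text \<open>A homotopy restricts to a subspace once each of its stages, not only the two ends, maps
  the subspace into itself.\<close>

lemma homotopic_to_id_on_wild_space:
  assumes "homotopic_with (\<lambda>_. True) X X p id"
  shows "homotopic_with (\<lambda>_. True) (wild_space n X) (wild_space n X) p id"
proof -
  obtain h where h: "continuous_map (prod_topology (top_of_set {0..1::real}) X) X h"
    and h0: "\<And>x. h (0, x) = p x" and h1: "\<And>x. h (1, x) = x"
    using assms by (auto simp: homotopic_with_def)
  have stage: "h (t, x) \<in> wild_set n X" if t: "t \<in> {0..1}" and x: "x \<in> wild_set n X" for t x
  proof -
    \<comment> \<open>Since the stage is homotopic to the identity, \<open>id\<close> itself serves
      as its left homotopy inverse; hence the form \<open>id \<circ> _\<close>.\<close>
    have "homotopic_with (\<lambda>_. True) X X (id \<circ> (\<lambda>x. h (t, x))) id"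
      using homotopy_stage_homotopic_to_end[OF h t] by (simp add: h1 id_def comp_def)
    moreover from this have "continuous_map X X (\<lambda>x. h (t, x))"
      by (auto dest: homotopic_with_imp_continuous_maps)
    ultimately show ?thesis
      using wild_set_mapped_by_left_homotopy_invertible[OF _ continuous_map_id _ x] by blast
  qed
  \<comment> \<open>The product with the wild space is a subspace of the full product, so continuity
    is inherited from \<open>h\<close>; \<open>stage\<close> confines the values.\<close>
  have "continuous_map (prod_topology (top_of_set {0..1}) (wild_space n X)) (wild_space n X) h"
    unfolding wild_space_def prod_topology_subtopology(2)
    using stage by (auto simp: continuous_map_in_subtopology
        intro: continuous_map_from_subtopology[OF h])
  then show ?thesis
    unfolding homotopic_with_def using h0 h1 by auto
qed

theorem theorem4p6:
  fixes X :: "'a topology" and Y :: "'b topology" and n :: nat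
  assumes "Hausdorff_space X" and "Hausdorff_space Y"
    and "X homotopy_equivalent_space Y"
  shows "wild_space n X homotopy_equivalent_space wild_space n Y"
proof -
  obtain f g where f: "continuous_map X Y f" and g: "continuous_map Y X g"
    and gf: "homotopic_with (\<lambda>_. True) X X (g \<circ> f) id"
    and fg: "homotopic_with (\<lambda>_. True) Y Y (f \<circ> g) id"
    using assms(3) by (auto simp: homotopy_equivalent_space_def)
  have "continuous_map (wild_space n X) (wild_space n Y) f"
    using wild_set_mapped_by_left_homotopy_invertible[OF f g gf]
    by (auto simp: wild_space_def continuous_map_in_subtopology
        intro: continuous_map_from_subtopology[OF f])
  moreover have "continuous_map (wild_space n Y) (wild_space n X) g"
    using wild_set_mapped_by_left_homotopy_invertible[OF g f fg]
    by (auto simp: wild_space_def continuous_map_in_subtopology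
        intro: continuous_map_from_subtopology[OF g])
  \<comment> \<open>The restricted maps are the same functions \<open>f\<close> and
    \<open>g\<close>, so their composites are covered by taking \<open>p\<close> to be
    \<open>g \<circ> f\<close> and \<open>f \<circ> g\<close>.\<close>
  ultimately show ?thesis
    unfolding homotopy_equivalent_space_def
    using homotopic_to_id_on_wild_space[OF gf] homotopic_to_id_on_wild_space[OF fg] by blast
qed

end
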